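(* Let $L\subset E$ be a linear subspace, let $X=\{x\in C: b-A(x)\in K\}$, and let $$\mathscr{C}=\{(y,w)\in K^*\times C^* : A^*(y)-w\in L\}.$$ Suppose there exist $\hat y\in\operatorname{ri}(K^* )$ and $\hat w\in\operatorname{ri}(C^* )$ such that $A^*(\hat y)-\hat w\in L$. Then $$\operatorname{Proj}_L X=\{x\in L : \langle A^*(y)-w,\,x\rangle\le\langle b,y\rangle\ \text{ for all extreme rays }(y,w)\text{ of }\mathscr{C}\}.$$
   Context: $E,E'$ are finite-dimensional real inner-product spaces; $C\subseteq E$ and $K\subseteq E'$ are nonempty closed convex cones (so they contain the origin), with $C\neq\{0\}$ and with $C\neq E$ or $K\neq E'$; $A:E\to E'$ is linear with adjoint $A^*:E'\to E$; $b\in E'$. For a cone $D$, $D^*=\{y:\langle x,y\rangle\ge 0\ \forall x\in D\}$ is its dual cone; $\operatorname{ri}$ denotes relative interior. The projection of $X$ onto $L$ is $\operatorname{Proj}_L X=\{x\in L : \exists\,u\in L^{\perp}\text{ such that }x+u\in X\}$, where $L^{\perp}$ is the orthogonal complement of $L$. The set $\mathscr{C}$ is a closed convex cone, and "extreme rays $(y,w)$ of $\mathscr{C}$" refers to the nonzero vectors spanning the extreme rays of $\mathscr{C}$.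
   Formalization: If the cone 𝒞 contains a line it has no half-line faces and the formula fails (C=[0,∞), K={0}, A=id, b=1, L=ℝ); extreme rays are therefore taken modulo the lineality space of 𝒞, whose nonzero vectors also count. For pointed 𝒞 this is the usual notion. *)

theory Defs
  imports "HOL-Analysis.Analysis"
begin

definition dual_cone :: "'a::real_inner set \<Rightarrow> 'a set" where
  "dual_cone D = {y. \<forall>x\<in>D. x \<bullet> y \<ge> 0}"

definition Proj :: "'a::euclidean_space set \<Rightarrow> 'a set \<Rightarrow> 'a set" where
  "Proj L X = {x \<in> L. \<exists>u \<in> L\<^sup>\<bottom>. x + u \<in> X}"

definition feasible_set ::
  "'a::euclidean_space set \<Rightarrow> 'b::euclidean_space set \<Rightarrow> ('a \<Rightarrow> 'b) \<Rightarrow> 'b \<Rightarrow> 'a set" where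
  "feasible_set C K A b = {x \<in> C. b - A x \<in> K}"

definition projection_cone ::
  "'a::euclidean_space set \<Rightarrow> 'b::euclidean_space set \<Rightarrow> ('a \<Rightarrow> 'b) \<Rightarrow> 'a set \<Rightarrow> ('b \<times> 'a) set" where
  "projection_cone C K A L = {(y, w) \<in> dual_cone K \<times> dual_cone C. adjoint A y - w \<in> L}"

(* For a convex cone S this is the largest linear subspace contained in S. *)
definition lineality_space :: "'a::real_vector set \<Rightarrow> 'a set" where
  "lineality_space S = S \<inter> uminus ` S"

(* v is a nonzero vector spanning an extreme ray of S. For pointed S: the half-line spanned by v
   is a face of S (lemma extreme_ray_pointed). A cone that contains a line has no half-line
   faces, and for K = {0} (equality constraints) the projection cone can contain lines; rays are
   then taken modulo the lineality space, and its own nonzero vectors are included. With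
   half-line faces only, the projection formula fails: for C = {0..}, K = {0}, A = id, b = 1,
   L = UNIV in the reals, the set X is {1} but there are no inequalities at all. *)
definition extreme_ray :: "'a::real_vector set \<Rightarrow> 'a \<Rightarrow> bool" where
  "extreme_ray S v \<longleftrightarrow>
     v \<noteq> 0 \<and> {r + l |r l. r \<in> cone hull {v} \<and> l \<in> lineality_space S} face_of S"

lemma extreme_ray_pointed:
  assumes "lineality_space S = {0}"
  shows "extreme_ray S v \<longleftrightarrow> v \<noteq> 0 \<and> (cone hull {v}) face_of S"
  using assms by (simp add: extreme_ray_def)

end

theory Submission
  imports Defs
begin

text \<open>
  A point \<open>x\<close> of \<open>L\<close> lies in the projection of the feasible set iff \<open>x + u \<in> C\<close> and
  \<open>b - A (x + u) \<in> K\<close> for some \<open>u\<close> orthogonal to \<open>L\<close>. This says that the pair \<open>(b - A x, x)\<close>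
  belongs to \<open>D + N\<close>, where \<open>D = K \<times> C\<close> and \<open>N\<close> is the subspace of all \<open>(A u, -u)\<close> with \<open>u\<close>
  orthogonal to \<open>L\<close>. The projection cone is exactly the set of all elements of the dual cone of
  \<open>D\<close> that are orthogonal to \<open>N\<close>. If \<open>D + N\<close> is closed, separation
  therefore describes it by the inequalities given by all elements of the projection cone. It
  remains to show that \<open>D + N\<close> is closed and that extreme rays are enough.

  Both follow from one fact (\<open>rel_interior_dual_cone_coercive\<close>): a point \<open>z\<close> in the relative
  interior of the dual cone of a closed convex cone \<open>S\<close> is coercive on the pointed part of \<open>S\<close>,
  that is, \<open>v \<bullet> z\<close> is at least a positive multiple of \<open>norm v\<close> on the intersection of \<open>S\<close> with the
  orthogonal complement of its lineality space.

  \<^item> If moreover \<open>z\<close> is orthogonal to \<open>N\<close>, the pointed summand \<open>d\<close> of an element \<open>d + n\<close> of \<open>D + N\<close>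
    satisfies \<open>d \<bullet> z = (d + n) \<bullet> z\<close>, so it is bounded in terms of the sum. Hence
    \<open>D + N\<close> is locally the sum of a compact set and a subspace, and so it is closed
    (\<open>closed_cone_plus_subspace\<close>). This is where the relative interior hypothesis enters.

  \<^item> Applied to the projection cone, the same bound shows that the slice \<open>v \<bullet> z = 1\<close> of its pointed
    part is compact. By the theorem of Krein and Milman the slice is the convex hull of
    its extreme points, and these span extreme rays (\<open>nonneg_on_cone_if_nonneg_on_extreme_rays\<close>).
\<close>

section \<open>Dual cones and lineality spaces\<close>

lemma convex_cone_dual_cone: "convex_cone (dual_cone D)"
  by (auto simp: convex_cone_iff dual_cone_def inner_right_distrib)

lemma closed_dual_cone: "closed (dual_cone (D :: 'a::euclidean_space set))"
proof -
  have "dual_cone D = (\<Inter>x\<in>D. {y. x \<bullet> y \<ge> 0})"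
    by (auto simp: dual_cone_def)
  then show ?thesis
    by (simp add: closed_INT closed_halfspace_ge)
qed

lemma dual_cone_Times:
  assumes "0 \<in> K" "0 \<in> C"
  shows "dual_cone (K \<times> C) = dual_cone K \<times> dual_cone C"
proof (rule set_eqI, clarify)
  fix y w
  show "(y, w) \<in> dual_cone (K \<times> C) \<longleftrightarrow> (y, w) \<in> dual_cone K \<times> dual_cone C" (is "?l \<longleftrightarrow> ?r")
  proof
    assume l: ?l
    have "k \<bullet> y \<ge> 0" if "k \<in> K" for k
      using l that assms(2) by (fastforce simp: dual_cone_def)
    moreover have "c \<bullet> w \<ge> 0" if "c \<in> C" for c
      using l that assms(1) by (fastforce simp: dual_cone_def)
    ultimately show ?r
      by (simp add: dual_cone_def)
  qed (auto simp: dual_cone_def)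
qed

text \<open>
  Strict separation from a closed convex set gives a constant bound. On a cone, scaling turns it
  into the bound \<open>0\<close>.
\<close>

lemma dual_cone_separates:
  fixes D :: "'a::euclidean_space set"
  assumes "closed D" "convex_cone D" "p \<notin> D"
  obtains y where "y \<in> dual_cone D" "p \<bullet> y < 0"
proof -
  obtain a \<beta> where a: "a \<bullet> p < \<beta>" "\<And>x. x \<in> D \<Longrightarrow> a \<bullet> x > \<beta>"
    using separating_hyperplane_closed_point[of D p] assms by (auto simp: convex_cone_def)
  have "\<beta> < 0"
    using a(2)[of 0] convex_cone_contains_0[OF assms(2)] by simp
  have "x \<bullet> a \<ge> 0" if "x \<in> D" for x
  proof (rule ccontr)
    assume "\<not> x \<bullet> a \<ge> 0"
    then have neg: "a \<bullet> x < 0"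
      by (simp add: inner_commute)
    \<comment> \<open>The multiple of \<open>x\<close> that lies on the separating hyperplane.\<close>
    have "(\<beta> / (a \<bullet> x)) *\<^sub>R x \<in> D"
      using neg \<open>\<beta> < 0\<close> that by (intro convex_cone_scaleR assms) (auto simp: divide_nonpos_neg)
    from a(2)[OF this] neg show False
      by simp
  qed
  then have "a \<in> dual_cone D"
    by (simp add: dual_cone_def)
  moreover have "p \<bullet> a < 0"
    using a(1) \<open>\<beta> < 0\<close> by (simp add: inner_commute)
  ultimately show thesis
    by (rule that)
qed

lemma subspace_lineality_space:
  assumes S: "convex_cone S"
  shows "subspace (lineality_space S)"
proof -
  have mem: "x \<in> lineality_space S \<longleftrightarrow> x \<in> S \<and> - x \<in> S" for x
    by (force simp: lineality_space_def)
  show ?thesis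
    unfolding subspace_def
  proof (intro conjI ballI allI)
    show "0 \<in> lineality_space S"
      using convex_cone_contains_0[OF S] by (simp add: mem)
  next
    fix x y
    assume "x \<in> lineality_space S" "y \<in> lineality_space S"
    then show "x + y \<in> lineality_space S"
      using convex_cone_add[OF S, of x y] convex_cone_add[OF S, of "- x" "- y"] by (simp add: mem)
  next
    fix c :: real and x
    assume x: "x \<in> lineality_space S"
    show "c *\<^sub>R x \<in> lineality_space S"
    proof (cases "c \<ge> 0")
      case True
      then show ?thesis
        using x convex_cone_scaleR[OF S, of c x] convex_cone_scaleR[OF S, of c "- x"]
        by (simp add: mem)
    next
      case False
      then show ?thesis
        using x convex_cone_scaleR[OF S, of "- c" x] convex_cone_scaleR[OF S, of "- c" "- x"]
        by (simp add: mem)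
    qed
  qed
qed

lemma orthogonal_decomposition:
  fixes U :: "'a::euclidean_space set"
  assumes "subspace U"
  obtains v l where "v \<in> U\<^sup>\<bottom>" "l \<in> U" "x = v + l"
  using subspace_sum_orthogonal_comp[OF assms]
  by (metis UNIV_I set_plus_elim add.commute)

definition pointed_part :: "'a::euclidean_space set \<Rightarrow> 'a set" where
  "pointed_part S = S \<inter> (lineality_space S)\<^sup>\<bottom>"

lemma pointed_part_decomposition:
  assumes "convex_cone S" "x \<in> S"
  obtains v l where "v \<in> pointed_part S" "l \<in> lineality_space S" "x = v + l"
proof -
  obtain v l where vl: "v \<in> (lineality_space S)\<^sup>\<bottom>" "l \<in> lineality_space S" "x = v + l"
    using orthogonal_decomposition[OF subspace_lineality_space[OF assms(1)]] .
  have "- l \<in> S"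
    using vl(2) by (force simp: lineality_space_def)
  then have "x + - l \<in> S"
    by (intro convex_cone_add assms)
  then show thesis
    using that vl by (simp add: pointed_part_def)
qed

lemma convex_cone_pointed_part: "convex_cone S \<Longrightarrow> convex_cone (pointed_part S)"
  unfolding convex_cone_iff pointed_part_def
  by (simp add: subspace_orthogonal_comp subspace_0 subspace_add subspace_scale)

lemma closed_pointed_part: "closed S \<Longrightarrow> closed (pointed_part S)"
  by (simp add: pointed_part_def closed_Int closed_subspace subspace_orthogonal_comp)

lemma pointed_part_Int_lineality_space:
  "v \<in> pointed_part S \<Longrightarrow> v \<in> lineality_space S \<Longrightarrow> v = 0"
  by (auto simp: pointed_part_def orthogonal_comp_def orthogonal_def)

lemma lineality_space_orthogonal_dual_cone:
  assumes "l \<in> lineality_space S" "y \<in> dual_cone S"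
  shows "l \<bullet> y = 0"
proof -
  have "l \<bullet> y \<ge> 0" "- l \<bullet> y \<ge> 0"
    using assms unfolding lineality_space_def dual_cone_def by force+
  then show ?thesis
    by simp
qed

section \<open>Coercivity of relatively interior points of the dual cone\<close>

text \<open>
  A linear functional on the dual cone that is nonnegative and vanishes at a relatively
  interior point vanishes everywhere, because from any other point of the dual cone one can
  continue slightly beyond \<open>z\<close>. By separation, a vector on which the whole dual cone vanishes is in
  the lineality space.
\<close>

lemma rel_interior_dual_cone_vanish:
  fixes S :: "'a::euclidean_space set"
  assumes S: "closed S" "convex_cone S"
    and z: "z \<in> rel_interior (dual_cone S)"
    and v: "v \<in> S" "v \<bullet> z = 0"
  shows "v \<in> lineality_space S"
proof -
  have "- v \<in> S"
  proof (rule ccontr)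
    assume "- v \<notin> S"
    then obtain y where y: "y \<in> dual_cone S" "- v \<bullet> y < 0"
      using dual_cone_separates[OF S] by blast
    have "convex (dual_cone S)" "dual_cone S \<noteq> {}"
      using convex_cone_dual_cone[of S] by (auto simp: convex_cone_def)
    then obtain e where e: "e > 1" "(1 - e) *\<^sub>R y + e *\<^sub>R z \<in> dual_cone S"
      using z y(1) by (auto simp: convex_rel_interior_iff)
    then have "v \<bullet> ((1 - e) *\<^sub>R y + e *\<^sub>R z) \<ge> 0"
      using v(1) by (simp add: dual_cone_def)
    then have "(1 - e) * (v \<bullet> y) \<ge> 0"
      using v(2) by (simp add: inner_add_right)
    then show False
      using e(1) y(2) by (simp add: zero_le_mult_iff)
  qed
  then show ?thesis
    using v(1) by (force simp: lineality_space_def)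
qed

text \<open>
  The bound is the minimum of \<open>v \<bullet> z\<close> over the unit vectors of the pointed part, which form a
  compact set on which \<open>v \<bullet> z\<close> is positive.
\<close>

lemma rel_interior_dual_cone_coercive:
  fixes S :: "'a::euclidean_space set"
  assumes S: "closed S" "convex_cone S"
    and z: "z \<in> rel_interior (dual_cone S)"
  obtains e where "e > 0" "\<And>v. v \<in> pointed_part S \<Longrightarrow> e * norm v \<le> v \<bullet> z"
proof -
  have zdual: "z \<in> dual_cone S"
    using z rel_interior_subset by blast
  define Q where "Q = pointed_part S \<inter> sphere 0 1"
  have "compact Q"
    unfolding Q_def by (intro closed_Int_compact closed_pointed_part S compact_sphere)
  have pos: "v \<bullet> z > 0" if "v \<in> Q" for v
  proof -
    have "v \<in> S" "v \<in> pointed_part S" "v \<noteq> 0"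
      using that by (auto simp: Q_def pointed_part_def)
    then have "v \<bullet> z \<noteq> 0"
      using rel_interior_dual_cone_vanish[OF S z] pointed_part_Int_lineality_space by blast
    moreover have "v \<bullet> z \<ge> 0"
      using zdual \<open>v \<in> S\<close> by (simp add: dual_cone_def)
    ultimately show ?thesis
      by simp
  qed
  obtain e where e: "e > 0" "\<And>v. v \<in> Q \<Longrightarrow> e \<le> v \<bullet> z"
  proof (cases "Q = {}")
    case True
    \<comment> \<open>The pointed part is \<open>{0}\<close>, and any positive constant will do.\<close>
    then show ?thesis
      using that[of 1] by simp
  next
    case False
    then obtain q where "q \<in> Q" "\<forall>v\<in>Q. q \<bullet> z \<le> v \<bullet> z"
      using continuous_attains_inf[OF \<open>compact Q\<close> False, of "\<lambda>v. v \<bullet> z"]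
        continuous_on_inner[OF continuous_on_id continuous_on_const, of Q z]
      by auto
    then show ?thesis
      using that[of "q \<bullet> z"] pos by blast
  qed
  have "e * norm v \<le> v \<bullet> z" if v: "v \<in> pointed_part S" for v
  proof (cases "v = 0")
    case False
    have "inverse (norm v) *\<^sub>R v \<in> Q"
      using False convex_cone_scaleR[OF convex_cone_pointed_part[OF S(2)] _ v]
      by (simp add: Q_def)
    from e(2)[OF this] show ?thesis
      using False by (simp add: field_simps)
  qed simp
  with e(1) show thesis
    by (rule that)
qed

section \<open>Closedness of the sum of a cone and a subspace\<close>

text \<open>
  The lineality space of \<open>D\<close> is absorbed into the subspace, and it is orthogonal to \<open>z\<close> too. So
  for \<open>s = d + m\<close> with \<open>d\<close> in the pointed part, coercivity gives
  \<open>e * norm d \<le> d \<bullet> z = s \<bullet> z \<le> norm s * norm z\<close>: along a convergent sequence of sums the pointed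
  summands stay in a compact set.
\<close>

lemma closed_cone_plus_subspace:
  fixes D N :: "'a::euclidean_space set"
  assumes D: "closed D" "convex_cone D"
    and N: "subspace N"
    and z: "z \<in> rel_interior (dual_cone D)" "z \<in> N\<^sup>\<bottom>"
  shows "closed (D + N)"
proof -
  obtain e where e: "e > 0" "\<And>v. v \<in> pointed_part D \<Longrightarrow> e * norm v \<le> v \<bullet> z"
    using rel_interior_dual_cone_coercive[OF D z(1)] by blast
  have zdual: "z \<in> dual_cone D"
    using z(1) rel_interior_subset by blast
  define M where "M = lineality_space D + N"
  have M: "subspace M"
  proof -
    have "M = {x + y |x y. x \<in> lineality_space D \<and> y \<in> N}"
      by (auto simp: M_def set_plus_def)
    then show ?thesis
      using subspace_sums[OF subspace_lineality_space[OF D(2)] N] by simp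
  qed
  have Mz: "m \<bullet> z = 0" if "m \<in> M" for m
    using that z(2) lineality_space_orthogonal_dual_cone[OF _ zdual]
    by (auto simp: M_def set_plus_def orthogonal_comp_def orthogonal_def inner_add_left)
  have DN: "D + N = pointed_part D + M"
  proof
    show "D + N \<subseteq> pointed_part D + M"
    proof
      fix s
      assume "s \<in> D + N"
      then obtain d n where d: "d \<in> D" "n \<in> N" "s = d + n"
        by (rule set_plus_elim)
      obtain v l where "v \<in> pointed_part D" "l \<in> lineality_space D" "d = v + l"
        using pointed_part_decomposition[OF D(2) d(1)] .
      then show "s \<in> pointed_part D + M"
        using d set_plus_intro[of v _ "l + n" M] set_plus_intro[of l "lineality_space D" n N]
        by (simp add: M_def add.assoc)
    qed
    show "pointed_part D + M \<subseteq> D + N"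
    proof
      fix s
      assume "s \<in> pointed_part D + M"
      then obtain v l n where "v \<in> pointed_part D" "l \<in> lineality_space D" "n \<in> N" "s = v + (l + n)"
        unfolding M_def by (metis set_plus_elim)
      moreover from this have "v + l \<in> D"
        by (intro convex_cone_add D) (auto simp: pointed_part_def lineality_space_def)
      ultimately show "s \<in> D + N"
        using set_plus_intro[of "v + l" D n N] by (simp add: add.assoc)
    qed
  qed
  show ?thesis
    unfolding closed_sequential_limits
  proof (intro allI impI, elim conjE)
    fix s l
    assume s: "\<forall>k. s k \<in> D + N" and lim: "s \<longlonglongrightarrow> l"
    obtain B where B: "\<And>k. norm (s k) \<le> B"
      using convergent_imp_bounded[OF lim] by (auto simp: bounded_iff)
    define P where "P = pointed_part D \<inter> cball 0 (B * norm z / e)"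
    have sk: "s k \<in> (\<Union>x\<in>P. \<Union>y\<in>M. {x + y})" for k
    proof -
      obtain d m where dm: "d \<in> pointed_part D" "m \<in> M" "s k = d + m"
        using s DN by (metis set_plus_elim)
      have "e * norm d \<le> s k \<bullet> z"
        using e(2)[OF dm(1)] Mz[OF dm(2)] by (simp add: dm(3) inner_add_left)
      also have "\<dots> \<le> norm (s k) * norm z"
        by (rule norm_cauchy_schwarz)
      also have "\<dots> \<le> B * norm z"
        using B by (intro mult_right_mono) auto
      finally have "d \<in> P"
        using dm(1) e(1) by (simp add: P_def field_simps)
      with dm(2,3) show ?thesis
        by auto
    qed
    have "closed (\<Union>x\<in>P. \<Union>y\<in>M. {x + y})"
      unfolding P_def
      by (intro compact_closed_sums closed_Int_compact closed_pointed_part D compact_cball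
          closed_subspace M)
    then have "l \<in> (\<Union>x\<in>P. \<Union>y\<in>M. {x + y})"
      using sk lim by (meson closed_sequentially)
    then show "l \<in> D + N"
      unfolding DN P_def by (auto intro: set_plus_intro)
  qed
qed

lemma dual_cone_plus_subspace:
  assumes "convex_cone D" "subspace N"
  shows "dual_cone (D + N) = dual_cone D \<inter> N\<^sup>\<bottom>"
proof
  show "dual_cone (D + N) \<subseteq> dual_cone D \<inter> N\<^sup>\<bottom>"
  proof
    fix y
    assume y: "y \<in> dual_cone (D + N)"
    have "d \<bullet> y \<ge> 0" if "d \<in> D" for d
      using y set_plus_intro[OF that subspace_0[OF assms(2)]] by (simp add: dual_cone_def)
    moreover have "n \<bullet> y \<ge> 0" if "n \<in> N" for n
      using y set_plus_intro[OF convex_cone_contains_0[OF assms(1)] that]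
      by (simp add: dual_cone_def)
    then have "n \<bullet> y = 0" if "n \<in> N" for n
      using that subspace_neg[OF assms(2) that]
      by (metis inner_minus_left neg_0_le_iff_le order_antisym)
    ultimately show "y \<in> dual_cone D \<inter> N\<^sup>\<bottom>"
      by (auto simp: dual_cone_def orthogonal_comp_def orthogonal_def)
  qed
  show "dual_cone D \<inter> N\<^sup>\<bottom> \<subseteq> dual_cone (D + N)"
    by (auto simp: dual_cone_def orthogonal_comp_def orthogonal_def set_plus_def inner_add_left)
qed

lemma mem_cone_plus_subspace_iff:
  fixes D N :: "'a::euclidean_space set"
  assumes D: "closed D" "convex_cone D"
    and N: "subspace N"
    and z: "z \<in> rel_interior (dual_cone D)" "z \<in> N\<^sup>\<bottom>"
  shows "p \<in> D + N \<longleftrightarrow> (\<forall>q \<in> dual_cone D \<inter> N\<^sup>\<bottom>. p \<bullet> q \<ge> 0)"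
proof -
  have "convex_cone (D + N)"
  proof -
    have "convex_cone N"
      using N by (simp add: convex_cone_iff subspace_0 subspace_add subspace_scale)
    moreover have "D + N = (\<Union>x\<in>D. \<Union>y\<in>N. {x + y})"
      by (auto simp: set_plus_def)
    ultimately show ?thesis
      using convex_cone_sums[OF D(2)] by simp
  qed
  then show ?thesis
    using dual_cone_separates[OF closed_cone_plus_subspace[OF D N z], of p]
    unfolding dual_cone_plus_subspace[OF D(2) N, symmetric]
    by (auto simp: dual_cone_def not_le[symmetric])
qed

section \<open>Extreme rays\<close>

text \<open>
  The following two lemmas show that an extreme point \<open>p\<close> of the slice \<open>v \<bullet> z = 1\<close> of the pointed
  part spans an extreme ray. The first one says that the ray of \<open>p\<close> is a face of the pointed part:
  when a multiple of \<open>p\<close> is a positive combination of \<open>a\<close> and \<open>b\<close>, rescaling \<open>a\<close> and \<open>b\<close> into the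
  slice displays \<open>p\<close> as a convex combination. The only vector that cannot be rescaled is \<open>0\<close>.
\<close>

lemma extreme_point_of_slice_summand:
  fixes Q :: "'a::euclidean_space set"
  assumes Q: "convex_cone Q"
    and pos: "\<And>v. v \<in> Q \<Longrightarrow> v \<noteq> 0 \<Longrightarrow> v \<bullet> z > 0"
    and p: "p extreme_point_of {v \<in> Q. v \<bullet> z = 1}"
    and ab: "a \<in> Q" "b \<in> Q" "s > 0" "t > 0" "s *\<^sub>R a + t *\<^sub>R b = c *\<^sub>R p"
  shows "a = (a \<bullet> z) *\<^sub>R p"
proof -
  have pz: "p \<bullet> z = 1"
    using p by (simp add: extreme_point_of_def)
  have c: "c = s * (a \<bullet> z) + t * (b \<bullet> z)"
    using arg_cong[OF ab(5), of "\<lambda>v. v \<bullet> z"] pz by (simp add: inner_add_left)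
  consider "a = 0" | "b = 0" | "a \<noteq> 0" "b \<noteq> 0"
    by blast
  then show ?thesis
  proof cases
    case 1
    then show ?thesis
      by simp
  next
    case 2
    then have "s *\<^sub>R a = s *\<^sub>R ((a \<bullet> z) *\<^sub>R p)"
      using ab(5) c by simp
    then show ?thesis
      using ab(3) by (simp only: scaleR_cancel_left) simp
  next
    case 3
    define \<alpha> \<beta> where "\<alpha> = a \<bullet> z" and "\<beta> = b \<bullet> z"
    have \<alpha>\<beta>: "\<alpha> > 0" "\<beta> > 0"
      using 3 pos ab by (auto simp: \<alpha>_def \<beta>_def)
    define u v where "u = inverse \<alpha> *\<^sub>R a" and "v = inverse \<beta> *\<^sub>R b"
    have a: "a = \<alpha> *\<^sub>R u" and b: "b = \<beta> *\<^sub>R v"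
      using \<alpha>\<beta> by (simp_all add: u_def v_def)
    have uv: "u \<in> Q" "v \<in> Q" "u \<bullet> z = 1" "v \<bullet> z = 1"
      using \<alpha>\<beta> convex_cone_scaleR[OF Q] ab(1,2) by (auto simp: u_def v_def \<alpha>_def \<beta>_def)
    have c': "c = s * \<alpha> + t * \<beta>" "s * \<alpha> > 0" "t * \<beta> > 0"
      using c \<alpha>\<beta> ab(3,4) by (auto simp: \<alpha>_def \<beta>_def)
    then have "c > 0"
      by simp
    define r where "r = t * \<beta> / c"
    have r: "0 < r" "r < 1" "1 - r = s * \<alpha> / c"
      using c' \<open>c > 0\<close> by (auto simp: r_def field_simps)
    have "p = inverse c *\<^sub>R (s *\<^sub>R a + t *\<^sub>R b)"
      using \<open>c > 0\<close> by (simp add: ab(5))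
    also have "\<dots> = (1 - r) *\<^sub>R u + r *\<^sub>R v"
      unfolding r(3) unfolding r_def a b by (simp add: scaleR_add_right divide_inverse mult_ac)
    finally have puv: "p = (1 - r) *\<^sub>R u + r *\<^sub>R v" .
    have "u = v"
      using p uv puv r(1,2) unfolding extreme_point_of_def in_segment by blast
    then have "p = u"
      using puv by (simp add: scaleR_add_left[symmetric])
    then show ?thesis
      using a by (simp add: \<alpha>_def)
  qed
qed

text \<open>
  The second lemma adds the lineality space back: a segment of the cone that meets the sum of the
  ray and the lineality space projects orthogonally to a segment of the pointed part that meets
  the ray itself.
\<close>

lemma extreme_ray_if_extreme_point_of_slice:
  fixes S :: "'a::euclidean_space set"
  assumes S: "convex_cone S"
    and z: "z \<in> dual_cone S"
    and pos: "\<And>v. v \<in> pointed_part S \<Longrightarrow> v \<noteq> 0 \<Longrightarrow> v \<bullet> z > 0"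
    and p: "p extreme_point_of {v \<in> pointed_part S. v \<bullet> z = 1}"
  shows "extreme_ray S p"
proof -
  let ?U = "lineality_space S"
  let ?F = "{r + l |r l. r \<in> cone hull {p} \<and> l \<in> ?U}"
  have U: "subspace ?U"
    by (rule subspace_lineality_space[OF S])
  have pS: "p \<in> pointed_part S" "p \<bullet> z = 1"
    using p by (auto simp: extreme_point_of_def)
  have F: "x \<in> ?F \<longleftrightarrow> (\<exists>c\<ge>0. \<exists>l\<in>?U. x = c *\<^sub>R p + l)" for x
    by (auto simp: cone_hull_expl)
  have "?F face_of S"
    unfolding face_of_def
  proof (intro conjI ballI impI)
    show "?F \<subseteq> S"
    proof
      fix x
      assume "x \<in> ?F"
      then obtain c l where "c \<ge> 0" "l \<in> ?U" "x = c *\<^sub>R p + l"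
        using F by blast
      then show "x \<in> S"
        using pS(1) S
        by (auto intro!: convex_cone_add convex_cone_scaleR simp: pointed_part_def lineality_space_def)
    qed
    have "?F = (\<Union>x\<in>cone hull {p}. \<Union>y\<in>?U. {x + y})"
      by auto
    then show "convex ?F"
      using convex_sums[OF convex_cone_hull[OF convex_singleton] subspace_imp_convex[OF U]] by simp
  next
    fix a b x
    assume ab: "a \<in> S" "b \<in> S" and x: "x \<in> ?F" "x \<in> open_segment a b"
    obtain t where t: "0 < t" "t < 1" "x = (1 - t) *\<^sub>R a + t *\<^sub>R b"
      using x(2) by (auto simp: in_segment)
    obtain c l where cl: "c \<ge> 0" "l \<in> ?U" "x = c *\<^sub>R p + l"
      using x(1) F by blast
    obtain a1 a2 where a: "a1 \<in> pointed_part S" "a2 \<in> ?U" "a = a1 + a2"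
      using pointed_part_decomposition[OF S ab(1)] .
    obtain b1 b2 where b: "b1 \<in> pointed_part S" "b2 \<in> ?U" "b = b1 + b2"
      using pointed_part_decomposition[OF S ab(2)] .
    \<comment> \<open>The two decompositions of \<open>x\<close> agree, since their difference \<open>d\<close> lies both in the lineality
      space and in its orthogonal complement.\<close>
    define d where "d = (1 - t) *\<^sub>R a1 + t *\<^sub>R b1 - c *\<^sub>R p"
    have "d = l - ((1 - t) *\<^sub>R a2 + t *\<^sub>R b2)"
      using t(3) cl(3) unfolding d_def a(3) b(3) by (simp add: algebra_simps)
    then have "d \<in> ?U"
      using U a b cl by (simp add: subspace_add subspace_diff subspace_scale)
    moreover have "d \<in> ?U\<^sup>\<bottom>"
      using a b pS(1) subspace_orthogonal_comp[of ?U] unfolding d_def pointed_part_def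
      by (simp add: subspace_add subspace_diff subspace_scale)
    ultimately have "d = 0"
      by (auto simp: orthogonal_comp_def orthogonal_def)
    then have comb: "(1 - t) *\<^sub>R a1 + t *\<^sub>R b1 = c *\<^sub>R p"
      by (simp add: d_def)
    note summand = extreme_point_of_slice_summand[OF convex_cone_pointed_part[OF S] pos p]
    have a1: "a1 = (a1 \<bullet> z) *\<^sub>R p"
      using summand[OF _ _ a(1) b(1) _ _ comb] t by simp
    have b1: "b1 = (b1 \<bullet> z) *\<^sub>R p"
      using summand[OF _ _ b(1) a(1) _ _ comb[unfolded add.commute[of "(1 - t) *\<^sub>R a1"]]] t by simp
    have nonneg: "a1 \<bullet> z \<ge> 0" "b1 \<bullet> z \<ge> 0"
      using a(1) b(1) z by (auto simp: pointed_part_def dual_cone_def)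
    have "a = (a1 \<bullet> z) *\<^sub>R p + a2" "b = (b1 \<bullet> z) *\<^sub>R p + b2"
      using a(3) b(3) a1 b1 by simp_all
    then show "a \<in> ?F" "b \<in> ?F"
      unfolding F using a(2) b(2) nonneg by blast+
  qed
  then show ?thesis
    using pS(2) by (auto simp: extreme_ray_def)
qed

text \<open>
  For a nonzero vector of the lineality space, the ray plus the lineality space is the
  lineality space itself, which is the smallest nonempty face of the cone.
\<close>

lemma extreme_ray_if_mem_lineality_space:
  assumes S: "convex_cone S" and v: "v \<in> lineality_space S" "v \<noteq> 0"
  shows "extreme_ray S v"
proof -
  let ?U = "lineality_space S"
  have U: "subspace ?U"
    by (rule subspace_lineality_space[OF S])
  have neg: "x \<in> ?U \<longleftrightarrow> x \<in> S \<and> - x \<in> S" for x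
    by (force simp: lineality_space_def)
  have half: "a \<in> ?U"
    if "a \<in> S" "b \<in> S" "s > 0" "t \<ge> 0" "s *\<^sub>R a + t *\<^sub>R b \<in> ?U" for a b and s t :: real
  proof -
    have "t *\<^sub>R b + - (s *\<^sub>R a + t *\<^sub>R b) \<in> S"
      using that by (intro convex_cone_add convex_cone_scaleR S) (auto simp: neg)
    then have "inverse s *\<^sub>R (- (s *\<^sub>R a)) \<in> S"
      using that by (intro convex_cone_scaleR S) auto
    then show ?thesis
      using that by (simp add: neg)
  qed
  have "?U face_of S"
    unfolding face_of_def
  proof (intro conjI ballI impI)
    show "?U \<subseteq> S"
      by (simp add: lineality_space_def)
    show "convex ?U"
      by (rule subspace_imp_convex[OF U])
  next
    fix a b x
    assume ab: "a \<in> S" "b \<in> S" and x: "x \<in> ?U" "x \<in> open_segment a b"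
    obtain t where t: "0 < t" "t < 1" "x = (1 - t) *\<^sub>R a + t *\<^sub>R b"
      using x(2) by (auto simp: in_segment)
    show "a \<in> ?U"
      using half[of a b "1 - t" t] ab t x(1) by simp
    show "b \<in> ?U"
      using half[of b a t "1 - t"] ab t x(1) by (simp add: add.commute)
  qed
  moreover have "{r + l |r l. r \<in> cone hull {v} \<and> l \<in> ?U} = ?U"
  proof
    show "{r + l |r l. r \<in> cone hull {v} \<and> l \<in> ?U} \<subseteq> ?U"
      using U v(1) by (auto simp: cone_hull_expl subspace_add subspace_scale)
    show "?U \<subseteq> {r + l |r l. r \<in> cone hull {v} \<and> l \<in> ?U}"
      using cone_hull_contains_0[of "{v}"] by force
  qed
  ultimately show ?thesis
    using v(2) by (simp add: extreme_ray_def)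
qed

text \<open>
  The slice of the pointed part is compact by coercivity, hence the convex hull of its extreme
  points, and every element of the cone is a nonnegative multiple of a point of the slice plus an
  element of the lineality space.
\<close>

lemma nonneg_on_cone_if_nonneg_on_extreme_rays:
  fixes S :: "'a::euclidean_space set"
  assumes S: "closed S" "convex_cone S"
    and f: "\<And>v. extreme_ray S v \<Longrightarrow> f \<bullet> v \<ge> 0"
    and x: "x \<in> S"
  shows "f \<bullet> x \<ge> 0"
proof -
  have "convex (dual_cone S)" "dual_cone S \<noteq> {}"
    using convex_cone_dual_cone[of S] by (auto simp: convex_cone_def)
  then obtain z where z: "z \<in> rel_interior (dual_cone S)"
    using rel_interior_eq_empty by blast
  then have zdual: "z \<in> dual_cone S"
    using rel_interior_subset by blast
  obtain e where e: "e > 0" "\<And>v. v \<in> pointed_part S \<Longrightarrow> e * norm v \<le> v \<bullet> z"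
    using rel_interior_dual_cone_coercive[OF S z] by blast
  have pos: "v \<bullet> z > 0" if "v \<in> pointed_part S" "v \<noteq> 0" for v
  proof -
    have "0 < e * norm v"
      using e(1) that(2) by simp
    with e(2)[OF that(1)] show ?thesis
      by simp
  qed
  define B where "B = {v \<in> pointed_part S. v \<bullet> z = 1}"
  have B: "B = pointed_part S \<inter> {v. z \<bullet> v = 1}"
    by (auto simp: B_def inner_commute)
  have "closed B"
    unfolding B by (intro closed_Int closed_pointed_part S closed_hyperplane)
  moreover have "bounded B"
    unfolding bounded_iff
  proof (intro exI ballI)
    fix v
    assume "v \<in> B"
    then show "norm v \<le> inverse e"
      using e(1) e(2)[of v] by (simp add: B_def field_simps)
  qed
  ultimately have "compact B"
    by (simp add: compact_eq_bounded_closed)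
  moreover have "convex B"
    unfolding B using convex_cone_pointed_part[OF S(2)]
    by (intro convex_Int convex_hyperplane) (simp add: convex_cone_def)
  ultimately have hull: "B = convex hull {v. v extreme_point_of B}"
    by (rule Krein_Milman_Minkowski)
  have "convex hull {v. v extreme_point_of B} \<subseteq> {v. f \<bullet> v \<ge> 0}"
  proof (rule hull_minimal)
    show "{v. v extreme_point_of B} \<subseteq> {v. f \<bullet> v \<ge> 0}"
      using f extreme_ray_if_extreme_point_of_slice[OF S(2) zdual pos] by (auto simp: B_def)
    show "convex {v. f \<bullet> v \<ge> 0}"
      by (rule convex_halfspace_ge)
  qed
  then have fB: "f \<bullet> v \<ge> 0" if "v \<in> B" for v
    using that hull by blast
  obtain v l where vl: "v \<in> pointed_part S" "l \<in> lineality_space S" "x = v + l"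
    using pointed_part_decomposition[OF S(2) x] .
  have "f \<bullet> v \<ge> 0"
  proof (cases "v = 0")
    case False
    have vz: "v \<bullet> z > 0"
      using pos[OF vl(1) False] .
    have "inverse (v \<bullet> z) *\<^sub>R v \<in> B"
      using vz convex_cone_scaleR[OF convex_cone_pointed_part[OF S(2)] _ vl(1)] by (simp add: B_def)
    from fB[OF this] vz show ?thesis
      by (simp add: zero_le_mult_iff)
  qed simp
  moreover have "f \<bullet> l \<ge> 0"
    using f extreme_ray_if_mem_lineality_space[OF S(2) vl(2)] by (cases "l = 0") auto
  ultimately show ?thesis
    by (simp add: vl(3) inner_add_right)
qed

lemma extreme_ray_imp_mem:
  assumes "convex_cone S" "extreme_ray S v"
  shows "v \<in> S"
proof -
  have "v \<in> cone hull {v}"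
    by (simp add: hull_inc)
  moreover have "0 \<in> lineality_space S"
    using subspace_0[OF subspace_lineality_space[OF assms(1)]] .
  ultimately have "v \<in> {r + l |r l. r \<in> cone hull {v} \<and> l \<in> lineality_space S}"
    by force
  then show ?thesis
    using assms(2) face_of_imp_subset unfolding extreme_ray_def by blast
qed

section \<open>The projection formula\<close>

text \<open>
  Moving \<open>x\<close> by \<open>u\<close> changes the pair \<open>(b - A x, x)\<close> by \<open>- (A u, - u)\<close>; these are the directions
  that the projection forgets.
\<close>

definition lift_subspace ::
  "('a::euclidean_space \<Rightarrow> 'b::euclidean_space) \<Rightarrow> 'a set \<Rightarrow> ('b \<times> 'a) set" where
  "lift_subspace A L = (\<lambda>u. (A u, - u)) ` (L\<^sup>\<bottom>)"

lemma subspace_lift_subspace: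
  assumes "linear A"
  shows "subspace (lift_subspace A L)"
proof -
  have "linear (\<lambda>u. (A u, - u))"
    using assms by (auto simp: linear_iff)
  then show ?thesis
    unfolding lift_subspace_def by (intro linear_subspace_image subspace_orthogonal_comp)
qed

text \<open>
  Orthogonality of \<open>(y, w)\<close> to all \<open>(A u, -u)\<close> says that \<open>A\<^sup>* y - w\<close> is orthogonal to the
  orthogonal complement of \<open>L\<close>, so that it lies in \<open>L\<close>.
\<close>

lemma orthogonal_comp_lift_subspace:
  assumes "linear A" "subspace L"
  shows "(y, w) \<in> (lift_subspace A L)\<^sup>\<bottom> \<longleftrightarrow> adjoint A y - w \<in> L"
proof -
  have "(y, w) \<in> (lift_subspace A L)\<^sup>\<bottom> \<longleftrightarrow> (\<forall>u\<in>L\<^sup>\<bottom>. A u \<bullet> y - u \<bullet> w = 0)"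
    unfolding orthogonal_comp_def[of "lift_subspace A L"]
    by (simp add: lift_subspace_def orthogonal_def)
  also have "\<dots> \<longleftrightarrow> adjoint A y - w \<in> L\<^sup>\<bottom>\<^sup>\<bottom>"
    unfolding orthogonal_comp_def[of "L\<^sup>\<bottom>"]
    by (simp add: orthogonal_def inner_diff_right adjoint_works[OF assms(1)])
  finally show ?thesis
    by (simp add: orthogonal_comp_self[OF assms(2)])
qed

lemma projection_cone_eq:
  assumes "0 \<in> K" "0 \<in> C" "linear A" "subspace L"
  shows "projection_cone C K A L = dual_cone (K \<times> C) \<inter> (lift_subspace A L)\<^sup>\<bottom>"
  using orthogonal_comp_lift_subspace[OF assms(3,4)]
  by (auto simp: projection_cone_def dual_cone_Times[OF assms(1,2)])

lemma mem_Proj_feasible_set_iff: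
  assumes "linear A" "x \<in> L"
  shows "x \<in> Proj L (feasible_set C K A b) \<longleftrightarrow> (b - A x, x) \<in> K \<times> C + lift_subspace A L"
proof
  assume "x \<in> Proj L (feasible_set C K A b)"
  then obtain u where u: "u \<in> L\<^sup>\<bottom>" "x + u \<in> C" "b - A (x + u) \<in> K"
    by (auto simp: Proj_def feasible_set_def)
  have "(b - A x, x) = (b - A (x + u), x + u) + (A u, - u)"
    using linear_add[OF assms(1)] by simp
  then show "(b - A x, x) \<in> K \<times> C + lift_subspace A L"
    using u by (auto simp only: lift_subspace_def intro!: set_plus_intro)
next
  assume "(b - A x, x) \<in> K \<times> C + lift_subspace A L"
  then obtain k c u where u: "k \<in> K" "c \<in> C" "u \<in> L\<^sup>\<bottom>" "b - A x = k + A u" "x = c - u"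
    by (auto simp: set_plus_def lift_subspace_def)
  then have "x + u \<in> C" "b - A (x + u) \<in> K"
    using linear_add[OF assms(1), of x u] by (auto simp: algebra_simps)
  then show "x \<in> Proj L (feasible_set C K A b)"
    using u(3) assms(2) by (auto simp: Proj_def feasible_set_def)
qed


theorem theorem4:
  fixes C L :: "'a::euclidean_space set"
    and K :: "'b::euclidean_space set"
    and A :: "'a \<Rightarrow> 'b"
    and b :: 'b
  assumes "closed C" and "convex_cone C"
    and "closed K" and "convex_cone K"
    and "C \<noteq> {0}"
    and "C \<noteq> UNIV \<or> K \<noteq> UNIV"
    and "linear A"
    and "subspace L"
    and "\<exists>y \<in> rel_interior (dual_cone K). \<exists>w \<in> rel_interior (dual_cone C). adjoint A y - w \<in> L"
  shows "Proj L (feasible_set C K A b) =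
    {x \<in> L. \<forall>y w. extreme_ray (projection_cone C K A L) (y, w)
                 \<longrightarrow> (adjoint A y - w) \<bullet> x \<le> b \<bullet> y}"
proof (rule set_eqI)
  fix x
  let ?D = "K \<times> C" and ?N = "lift_subspace A L" and ?S = "projection_cone C K A L"
  let ?p = "(b - A x, x)"
  have zero: "0 \<in> K" "0 \<in> C"
    using assms(2,4) by (auto intro: convex_cone_contains_0)
  have D: "closed ?D" "convex_cone ?D"
    using assms by (auto intro: closed_Times convex_cone_Times)
  have N: "subspace ?N"
    using assms(7) by (rule subspace_lift_subspace)
  have S: "?S = dual_cone ?D \<inter> ?N\<^sup>\<bottom>"
    using zero assms(7,8) by (rule projection_cone_eq)
  have closed: "closed ?S"
    unfolding S by (intro closed_Int closed_dual_cone closed_subspace subspace_orthogonal_comp)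
  have cone: "convex_cone ?S"
    using convex_cone_dual_cone[of ?D] subspace_orthogonal_comp[of ?N]
    unfolding S convex_cone_iff subspace_def by blast
  obtain y w where yw: "y \<in> rel_interior (dual_cone K)" "w \<in> rel_interior (dual_cone C)"
    "adjoint A y - w \<in> L"
    using assms(9) by blast
  have "convex (dual_cone K)" "convex (dual_cone C)"
    using convex_cone_dual_cone[of K] convex_cone_dual_cone[of C] by (auto simp: convex_cone_def)
  then have z: "(y, w) \<in> rel_interior (dual_cone ?D)"
    using yw by (simp add: dual_cone_Times[OF zero] rel_interior_Times)
  have zN: "(y, w) \<in> ?N\<^sup>\<bottom>"
    using yw(3) orthogonal_comp_lift_subspace[OF assms(7,8)] by simp
  have pairing: "?p \<bullet> (y, w) \<ge> 0 \<longleftrightarrow> (adjoint A y - w) \<bullet> x \<le> b \<bullet> y" for y w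
    using adjoint_works[OF assms(7), of x y]
    by (simp add: inner_diff_left inner_commute algebra_simps)
  have "x \<in> Proj L (feasible_set C K A b) \<longleftrightarrow> x \<in> L \<and> ?p \<in> ?D + ?N"
    using mem_Proj_feasible_set_iff[OF assms(7), of x L] by (auto simp: Proj_def)
  also have "?p \<in> ?D + ?N \<longleftrightarrow> (\<forall>q \<in> ?S. ?p \<bullet> q \<ge> 0)"
    unfolding S by (rule mem_cone_plus_subspace_iff[OF D N z zN])
  also have "(\<forall>q \<in> ?S. ?p \<bullet> q \<ge> 0) \<longleftrightarrow> (\<forall>q. extreme_ray ?S q \<longrightarrow> ?p \<bullet> q \<ge> 0)"
    using nonneg_on_cone_if_nonneg_on_extreme_rays[OF closed cone, of ?p]
      extreme_ray_imp_mem[OF cone] by blast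
  also have "\<dots> \<longleftrightarrow> (\<forall>y w. extreme_ray ?S (y, w) \<longrightarrow> (adjoint A y - w) \<bullet> x \<le> b \<bullet> y)"
    unfolding pairing[symmetric] by (rule split_paired_All)
  finally show "x \<in> Proj L (feasible_set C K A b) \<longleftrightarrow>
      x \<in> {x \<in> L. \<forall>y w. extreme_ray ?S (y, w) \<longrightarrow> (adjoint A y - w) \<bullet> x \<le> b \<bullet> y}"
    by simp
qed

end
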